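(* Let $b$ be a nonzero integer and let $k\geq -1$ be an integer with $k\in\chi(0,b)$. Let $p$ be an odd prime that is a $k$-PL prime relative to $(0,b)$. Let $H$ be a graph of order $\pi_p(0,b)-1$ and size $m$, and let $G$ be a connected graph of order $\pi_p(0,b)-1$ and size $(k+1)\bigl(m+\pi_p(0,b)-1\bigr)+\varepsilon$, where $\varepsilon\in\{-1,0,1\}$. If $p\equiv\pm1\pmod 8$ or $m=0$, then the corona graph $G\circ H$ is a $(0,b)$-FLC graph modulo $p$.
   Context: All graphs are finite and simple with nonempty vertex set; order means number of vertices and size means number of edges. For integers $a,b$, the $(a,b)$-Fibonacci sequence is $F_0=a$, $F_1=b$, $F_n=F_{n-1}+F_{n-2}$ for $n\ge 2$. $(x/p)$ denotes the Legendre symbol for an odd prime $p$ (equal to $0$ when $p\mid x$). The $(a,b)$-Pisano period $\pi_p(a,b)$ is the smallest positive integer $t$ such that $F_{n+t}\equiv F_n \pmod p$ for all $n\ge 0$. For an odd prime $p$ and $j\in\{-1,0,1\}$, let $\Lambda_j^p(a,b)=\{\xi\in\{0,1,\ldots,\pi_p(a,b)-1\} : (F_\xi/p)=j\}$. The prime $p$ is a $k$-PL prime ($k$-Pisano-Legendre prime) relative to $(a,b)$ if $k=|\Lambda_1^p(a,b)|-|\Lambda_{-1}^p(a,b)|-|\Lambda_0^p(a,b)|$. The Pisano set $\chi(a,b)$ is the set of all integers $k$ for which there exists an odd prime $p$ that is a $k$-PL prime relative to $(a,b)$. Let $\Gamma$ be a simple connected graph of order $N$. A bijection $f:V(\Gamma)\to\{0,1,\ldots,N-1\}$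 is an $(a,b)$-FLC labeling (Fibonacci-Legendre cordial labeling) modulo $p$ if the induced edge labeling $f_p^*:E(\Gamma)\to\{0,1\}$, given by $f_p^*(uv)=\frac{1+([F_{f(u)}+F_{f(v)}]/p)}{2}$ if $F_{f(u)}+F_{f(v)}\not\equiv 0\pmod p$ and $f_p^*(uv)=0$ otherwise, satisfies $|e_{f_p^*}(0)-e_{f_p^*}(1)|\le 1$, where $e_{f_p^*}(i)$ is the number of edges labeled $i$. A graph admitting such a labeling is an $(a,b)$-FLC graph modulo $p$. If $G_1$ has order $n$, the corona graph $G_1\circ G_2$ is obtained by taking one copy of $G_1$ and $n$ disjoint copies of $G_2$, and joining the $i$th vertex of $G_1$ to every vertex of the $i$th copy of $G_2$. *)

theory Defs
  imports "HOL-Number_Theory.Number_Theory" "Graph_Theory.Graph_Theory"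
begin

section \<open>Fibonacci sequences, Pisano periods and Pisano-Legendre primes\<close>

fun fibseq :: "int \<Rightarrow> int \<Rightarrow> nat \<Rightarrow> int" where
  "fibseq a b 0 = a"
| "fibseq a b (Suc 0) = b"
| "fibseq a b (Suc (Suc n)) = fibseq a b (Suc n) + fibseq a b n"

text \<open>A period always exists for a positive modulus, because the recurrence is
  reversible, so the least element below is attained and positive.\<close>
definition pisano_period :: "nat \<Rightarrow> int \<Rightarrow> int \<Rightarrow> nat" where
  "pisano_period p a b =
     (LEAST t. 0 < t \<and> (\<forall>n. [fibseq a b (n + t) = fibseq a b n] (mod int p)))"

definition PL_class :: "nat \<Rightarrow> int \<Rightarrow> int \<Rightarrow> int \<Rightarrow> nat set" where
  "PL_class p a b j = {\<xi>. \<xi> < pisano_period p a b \<and> Legendre (fibseq a b \<xi>) (int p) = j}"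

definition PL_prime :: "int \<Rightarrow> int \<Rightarrow> int \<Rightarrow> nat \<Rightarrow> bool" where
  "PL_prime k a b p \<longleftrightarrow> prime p \<and> odd p \<and>
     k = int (card (PL_class p a b 1)) - int (card (PL_class p a b (-1)))
         - int (card (PL_class p a b 0))"

definition pisano_set :: "int \<Rightarrow> int \<Rightarrow> int set" where
  "pisano_set a b = {k. \<exists>p. PL_prime k a b p}"

section \<open>Simple graphs\<close>

text \<open>As in the Graph Theory entry, a finite simple graph is a symmetric loop-free digraph
  whose arcs are ordered pairs.  An undirected edge thus appears as two arcs; edges are
  therefore counted as unordered pairs.\<close>
definition simple_graph :: "'a pair_pre_digraph \<Rightarrow> bool" where
  "simple_graph G \<longleftrightarrow> pair_graph G \<and> pverts G \<noteq> {}"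

definition edges :: "'a pair_pre_digraph \<Rightarrow> 'a set set" where
  "edges G = {{u, v} | u v. (u, v) \<in> parcs G}"

definition graph_order :: "'a pair_pre_digraph \<Rightarrow> nat" where
  "graph_order G = card (pverts G)"

definition graph_size :: "'a pair_pre_digraph \<Rightarrow> nat" where
  "graph_size G = card (edges G)"

abbreviation connected_graph :: "'a pair_pre_digraph \<Rightarrow> bool" where
  "connected_graph G \<equiv> Digraph_Component.connected (with_proj G)"

text \<open>\<^term>\<open>Inl u\<close> is the vertex \<open>u\<close> of \<open>G\<close>; \<^term>\<open>Inr (u, x)\<close> is the vertex \<open>x\<close> in the
  copy of \<open>H\<close> attached to \<open>u\<close>.\<close>
definition corona ::
  "'a pair_pre_digraph \<Rightarrow> 'b pair_pre_digraph \<Rightarrow> ('a + 'a \<times> 'b) pair_pre_digraph" where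
  "corona G H =
     \<lparr> pverts = Inl ` pverts G \<union> Inr ` (pverts G \<times> pverts H),
       parcs = {(Inl u, Inl v) | u v. (u, v) \<in> parcs G}
             \<union> {(Inr (u, x), Inr (u, y)) | u x y. u \<in> pverts G \<and> (x, y) \<in> parcs H}
             \<union> {(Inl u, Inr (u, x)) | u x. u \<in> pverts G \<and> x \<in> pverts H}
             \<union> {(Inr (u, x), Inl u) | u x. u \<in> pverts G \<and> x \<in> pverts H} \<rparr>"

lemma simple_graph_corona:
  assumes "simple_graph G" and "simple_graph H"
  shows "simple_graph (corona G H)"
proof -
  interpret G: pair_graph G using assms(1) by (simp add: simple_graph_def)
  interpret H: pair_graph H using assms(2) by (simp add: simple_graph_def)
  let ?C = "corona G H"
  have sub: "parcs ?C \<subseteq> pverts ?C \<times> pverts ?C"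
    by (auto simp: corona_def dest: G.in_arcsD1 G.in_arcsD2 H.in_arcsD1 H.in_arcsD2)
  have fin: "finite (pverts ?C)"
    by (simp add: corona_def)
  have "finite (parcs ?C)"
    using sub fin by (meson finite_SigmaI finite_subset)
  moreover have "sym (parcs ?C)"
    by (rule symI) (auto simp: corona_def dest: G.arcs_symmetric H.arcs_symmetric)
  moreover have "fst e \<noteq> snd e" if "e \<in> parcs ?C" for e
    using that by (auto simp: corona_def dest: G.no_loops' H.no_loops')
  ultimately have "pair_graph ?C"
    using sub fin by unfold_locales (auto simp: symmetric_def arcs_ends_def arc_to_ends_def)
  then show ?thesis
    using assms(1) by (auto simp: simple_graph_def corona_def)
qed

section \<open>Fibonacci-Legendre cordial labelings\<close>

text \<open>For an edge \<open>e = {u, v}\<close> with \<open>u \<noteq> v\<close>, the sum over \<open>e\<close> is \<open>F\<^bsub>f(u)\<^esub> + F\<^bsub>f(v)\<^esub>\<close>.  The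
  division is exact, as the Legendre symbol is \<open>1\<close> or \<open>-1\<close> in that branch.\<close>
definition FLC_edge_label :: "int \<Rightarrow> int \<Rightarrow> nat \<Rightarrow> ('a \<Rightarrow> nat) \<Rightarrow> 'a set \<Rightarrow> int" where
  "FLC_edge_label a b p f e =
     (let s = (\<Sum>w\<in>e. fibseq a b (f w))
      in if [s = 0] (mod int p) then 0 else (1 + Legendre s (int p)) div 2)"

definition edge_count ::
  "int \<Rightarrow> int \<Rightarrow> nat \<Rightarrow> 'a pair_pre_digraph \<Rightarrow> ('a \<Rightarrow> nat) \<Rightarrow> int \<Rightarrow> nat" where
  "edge_count a b p \<Gamma> f i = card {e \<in> edges \<Gamma>. FLC_edge_label a b p f e = i}"

definition FLC_labeling ::
  "int \<Rightarrow> int \<Rightarrow> nat \<Rightarrow> 'a pair_pre_digraph \<Rightarrow> ('a \<Rightarrow> nat) \<Rightarrow> bool" where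
  "FLC_labeling a b p \<Gamma> f \<longleftrightarrow>
     bij_betw f (pverts \<Gamma>) {0..<graph_order \<Gamma>} \<and>
     \<bar>int (edge_count a b p \<Gamma> f 0) - int (edge_count a b p \<Gamma> f 1)\<bar> \<le> 1"

definition FLC_graph :: "int \<Rightarrow> int \<Rightarrow> nat \<Rightarrow> 'a pair_pre_digraph \<Rightarrow> bool" where
  "FLC_graph a b p \<Gamma> \<longleftrightarrow>
     simple_graph \<Gamma> \<and> connected_graph \<Gamma> \<and> (\<exists>f. FLC_labeling a b p \<Gamma> f)"

end

(* Let t be the Pisano period.  The t - 1 vertices of G receive the multiples of t, so every edge
   of G has sum 0 mod p; the copies of H receive the t - 1 nonzero residue classes mod t, one class
   r each, so an edge from a copy to its root has sum F_r and an edge inside it has sum 2 F_r.  As 2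
   is a quadratic residue for p = 1, 7 (mod 8), both kinds of edges carry the same label, and the
   PL condition, with the zero class r = 0 removed, leaves (k + 1)(m + t - 1) more ones than zeros
   outside G; the size of G compensates this up to epsilon. *)

theory Submission
  imports Defs
begin

section \<open>Legendre symbols\<close>

lemma Legendre_cong:
  assumes "[x = y] (mod p)"
  shows "Legendre x p = Legendre y p"
proof -
  have "[x = 0] (mod p) \<longleftrightarrow> [y = 0] (mod p)" "QuadRes p x \<longleftrightarrow> QuadRes p y"
    using assms by (auto simp: QuadRes_def cong_def)
  then show ?thesis by (simp add: Legendre_def)
qed

text \<open>Gauss's lemma for the multiplier 2: the symbol is -1 to the number of x in 1..h, where h
  = (p - 1) / 2, whose double exceeds h. That number is even for these p.\<close>

lemma Legendre_2_eq_1: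
  fixes p :: nat
  assumes "prime p" and p8: "[int p = 1] (mod 8) \<or> [int p = -1] (mod 8)"
  shows "Legendre 2 (int p) = 1"
proof -
  define h where "h = (int p - 1) div 2"
  have p8': "int p mod 8 = 1 \<or> int p mod 8 = 7"
    using p8 by (auto simp: cong_def)
  then have "p \<noteq> 2" by auto
  then have "p > 2"
    using prime_ge_2_nat[OF \<open>prime p\<close>] by simp
  interpret GAUSS p 2
    using \<open>prime p\<close> \<open>p > 2\<close> by unfold_locales (auto simp: cong_def)
  have p_eq: "int p = 2 * h + 1"
    using p_eq2 by (simp add: h_def)
  \<comment> \<open>All doubles are at most p - 1, so reducing them mod p changes nothing.\<close>
  have "C = (\<lambda>x. x * 2) ` {0<..h}"
    unfolding C_def B_def A_def h_def[symmetric] image_image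
    by (rule image_cong) (auto simp: p_eq)
  then have "E = (\<lambda>x. x * 2) ` {h div 2<..h}"
    unfolding E_def h_def[symmetric] by (auto simp: p_eq)
  then have "card E = nat (h - h div 2)"
    by (simp add: card_image inj_on_def)
  \<comment> \<open>p = 8j + 1 gives h = 4j and difference 2j; p = 8j + 7 gives h = 4j + 3 and
    difference 2j + 2.\<close>
  moreover have "even (h - h div 2)" and "h \<ge> h div 2"
    using p8' p_eq \<open>p > 2\<close> by presburger+
  ultimately have "even (card E)"
    by (simp add: even_nat_iff)
  then show ?thesis
    using gauss_lemma by simp
qed

text \<open>Euler's criterion makes both sides congruent mod p. Both lie between -1 and 1, so they
  differ by at most 2 < p and are equal.\<close>

lemma Legendre_mult:
  fixes p :: nat
  assumes "prime p" and "p > 2"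
  shows "Legendre (x * y) (int p) = Legendre x (int p) * Legendre y (int p)"
proof -
  note ec = euler_criterion[OF assms]
  have "[Legendre (x * y) (int p) = x ^ ((p - 1) div 2) * y ^ ((p - 1) div 2)] (mod int p)"
    using ec[of "x * y"] by (simp add: power_mult_distrib)
  also have "[x ^ ((p - 1) div 2) * y ^ ((p - 1) div 2)
      = Legendre x (int p) * Legendre y (int p)] (mod int p)"
    by (intro cong_mult cong_sym[OF ec])
  finally have "int p dvd Legendre (x * y) (int p) - Legendre x (int p) * Legendre y (int p)"
    by (simp add: cong_iff_dvd_diff)
  moreover have "\<bar>Legendre z (int p)\<bar> \<le> 1" for z
    by (simp add: Legendre_def)
  then have "\<bar>Legendre (x * y) (int p)\<bar> \<le> 1" "\<bar>Legendre x (int p) * Legendre y (int p)\<bar> \<le> 1"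
    by (simp_all add: abs_mult mult_le_one)
  then have "\<bar>Legendre (x * y) (int p) - Legendre x (int p) * Legendre y (int p)\<bar> < \<bar>int p\<bar>"
    using \<open>p > 2\<close> by linarith
  ultimately show ?thesis
    using dvd_imp_le_int by (metis eq_iff_diff_eq_0 linorder_not_le)
qed

text \<open>Both the edge labelling and the definition of a PL prime group the value \<open>0\<close> of the
  Legendre symbol with \<open>-1\<close>; this sign encodes that convention.\<close>
definition qr_sign :: "nat \<Rightarrow> int \<Rightarrow> int" where
  "qr_sign p x = (if Legendre x (int p) = 1 then 1 else -1)"

lemma qr_sign_cong: "[x = y] (mod int p) \<Longrightarrow> qr_sign p x = qr_sign p y"
  by (simp add: qr_sign_def Legendre_cong)

lemma qr_sign_0 [simp]: "qr_sign p 0 = -1"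
  by (simp add: qr_sign_def Legendre_def)

text \<open>Serves the edges inside a copy of \<open>H\<close>, whose sums are congruent to twice a
  Fibonacci term: 2 is a square mod p, so multiplicativity leaves the symbol unchanged.\<close>

lemma qr_sign_double:
  assumes "prime p" and "[int p = 1] (mod 8) \<or> [int p = -1] (mod 8)"
  shows "qr_sign p (x + x) = qr_sign p x"
proof -
  have "p \<noteq> 2" using assms(2) by (auto simp: cong_def)
  then have "p > 2" using prime_ge_2_nat[OF assms(1)] by simp
  then show ?thesis
    using Legendre_mult[OF assms(1), of 2 x] Legendre_2_eq_1[OF assms]
    by (simp add: qr_sign_def)
qed

section \<open>Pisano periods\<close>

text \<open>The recurrence read backwards, F_n = F_(n+2) - F_(n+1), pulls a coincidence of
  consecutive pairs down to index 0. This yields a period from the start, not just an eventual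
  one.\<close>

lemma fibseq_cong_back:
  assumes "[fibseq a b i = fibseq a b j] (mod m)"
    and "[fibseq a b (Suc i) = fibseq a b (Suc j)] (mod m)" and "i \<le> j"
  shows "[fibseq a b 0 = fibseq a b (j - i)] (mod m) \<and>
         [fibseq a b (Suc 0) = fibseq a b (Suc (j - i))] (mod m)"
  using assms
proof (induction i arbitrary: j)
  case (Suc i)
  then obtain j' where j: "j = Suc j'" "i \<le> j'"
    by (cases j) auto
  have "[fibseq a b (Suc (Suc i)) - fibseq a b (Suc i)
       = fibseq a b (Suc (Suc j')) - fibseq a b (Suc j')] (mod m)"
    using Suc.prems j by (intro cong_diff) auto
  then have "[fibseq a b i = fibseq a b j'] (mod m)" by simp
  with Suc.IH[of j'] Suc.prems j show ?case by simp
qed simp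

text \<open>The recurrence has order two, so two consecutive residues determine all later
  ones.\<close>

lemma fibseq_cong_forward:
  assumes "[fibseq a b i = fibseq a b j] (mod m)"
    and "[fibseq a b (Suc i) = fibseq a b (Suc j)] (mod m)"
  shows "[fibseq a b (n + i) = fibseq a b (n + j)] (mod m)"
proof (induction n rule: less_induct)
  case (less n)
  consider "n = 0" | "n = Suc 0" | l where "n = Suc (Suc l)"
    by (metis not0_implies_Suc)
  then show ?case
  proof cases
    case 3
    then show ?thesis
      using cong_add[OF less[of "Suc l"] less[of l]] by simp
  qed (use assms in simp_all)
qed

text \<open>Pigeonhole: there are only m^2 pairs of consecutive residues, so the pairs at some i < j
  agree, and j - i is a period. Hence the \<open>LEAST\<close> in \<open>pisano_period\<close> is
  attained.\<close>

lemma ex_fibseq_period: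
  assumes "m > 0"
  shows "\<exists>t>0. \<forall>n. [fibseq a b (n + t) = fibseq a b n] (mod int m)"
proof -
  define s where "s n = (fibseq a b n mod int m, fibseq a b (Suc n) mod int m)" for n
  have "range s \<subseteq> {0..<int m} \<times> {0..<int m}"
    using assms by (auto simp: s_def)
  then have "finite (range s)"
    by (rule finite_subset) simp
  then have "\<not> inj s"
    using range_inj_infinite by blast
  then obtain i j where "i < j" "s i = s j"
    unfolding inj_def by (metis linorder_neqE_nat)
  then have ij: "[fibseq a b 0 = fibseq a b (j - i)] (mod int m)"
      "[fibseq a b (Suc 0) = fibseq a b (Suc (j - i))] (mod int m)"
    using fibseq_cong_back[of a b i j "int m"] by (auto simp: s_def cong_def)
  show ?thesis
    using fibseq_cong_forward[OF ij] \<open>i < j\<close>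
    by (intro exI[of _ "j - i"]) (auto intro: cong_sym)
qed

lemma fibseq_pisano_period:
  assumes "m > 0"
  shows "pisano_period m a b > 0"
    and "[fibseq a b (n + pisano_period m a b) = fibseq a b n] (mod int m)"
  using LeastI_ex[OF ex_fibseq_period[OF assms, of a b]] by (auto simp: pisano_period_def)

lemma fibseq_mult_pisano_period:
  assumes "m > 0"
  shows "[fibseq a b (q * pisano_period m a b + n) = fibseq a b n] (mod int m)"
proof (induction q)
  case (Suc q)
  then show ?case
    using fibseq_pisano_period(2)[OF assms, of a b "q * pisano_period m a b + n"]
    by (auto simp: algebra_simps intro: cong_trans)
qed simp

text \<open>The three classes partition one period and enter k with signs 1, -1, -1, which are the
  values of \<open>qr_sign\<close> on them.\<close>

lemma PL_prime_sum:
  assumes "PL_prime k a b p"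
  shows "(\<Sum>\<xi><pisano_period p a b. qr_sign p (fibseq a b \<xi>)) = k"
proof -
  let ?I = "{..<pisano_period p a b}"
  let ?L = "\<lambda>\<xi>. Legendre (fibseq a b \<xi>) (int p)"
  have card_eq: "int (card (PL_class p a b j)) = (\<Sum>\<xi>\<in>?I. if ?L \<xi> = j then 1 else 0)" for j
    by (auto simp: PL_class_def sum.If_cases Int_def)
  have "qr_sign p (fibseq a b \<xi>) =
      (if ?L \<xi> = 1 then 1 else 0) - (if ?L \<xi> = -1 then 1 else 0) - (if ?L \<xi> = 0 then 1 else 0)" for \<xi>
    by (auto simp: qr_sign_def Legendre_def)
  then show ?thesis
    using assms by (simp add: PL_prime_def card_eq sum_subtractf)
qed

section \<open>Corona graphs\<close>

lemma edges_simple_graph: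
  assumes "simple_graph G" and "e \<in> edges G"
  obtains u v where "e = {u, v}" "u \<noteq> v" "u \<in> pverts G" "v \<in> pverts G"
proof -
  interpret pair_graph G using assms(1) by (simp add: simple_graph_def)
  from assms(2) obtain u v where "e = {u, v}" "(u, v) \<in> parcs G"
    by (auto simp: edges_def)
  then show thesis
    using that no_loops' in_arcsD1 in_arcsD2 by blast
qed

lemma finite_simple_graph:
  assumes "simple_graph G"
  shows "finite (pverts G)" "finite (edges G)"
proof -
  interpret pair_graph G using assms by (simp add: simple_graph_def)
  show fin: "finite (pverts G)" by simp
  have "edges G \<subseteq> Pow (pverts G)"
    by (auto elim!: edges_simple_graph[OF assms])
  then show "finite (edges G)"
    using fin by (meson finite_Pow_iff finite_subset)
qed

lemma edges_corona:
  "edges (corona G H) =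
     (`) Inl ` edges G
     \<union> (\<lambda>(u, e). (\<lambda>x. Inr (u, x)) ` e) ` (pverts G \<times> edges H)
     \<union> (\<lambda>(u, x). {Inl u, Inr (u, x)}) ` (pverts G \<times> pverts H)"
  (is "?L = ?A \<union> ?B \<union> ?C")
proof
  show "?L \<subseteq> ?A \<union> ?B \<union> ?C"
  proof
    fix e assume "e \<in> ?L"
    then obtain s t where e: "e = {s, t}" and st: "(s, t) \<in> parcs (corona G H)"
      by (auto simp: edges_def)
    from st consider
      (G) u v where "s = Inl u" "t = Inl v" "(u, v) \<in> parcs G"
    | (H) u x y where "s = Inr (u, x)" "t = Inr (u, y)" "u \<in> pverts G" "(x, y) \<in> parcs H"
    | (out) u x where "s = Inl u" "t = Inr (u, x)" "u \<in> pverts G" "x \<in> pverts H"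
    | (into) u x where "t = Inl u" "s = Inr (u, x)" "u \<in> pverts G" "x \<in> pverts H"
      unfolding corona_def pair_pre_digraph.simps by blast
    then show "e \<in> ?A \<union> ?B \<union> ?C"
    proof cases
      case G
      then have "e = Inl ` {u, v}" "{u, v} \<in> edges G" by (auto simp: e edges_def)
      then show ?thesis by blast
    next
      case H
      then have "(u, {x, y}) \<in> pverts G \<times> edges H" by (auto simp: edges_def)
      moreover have "e = (case (u, {x, y}) of (u, e) \<Rightarrow> (\<lambda>x. Inr (u, x)) ` e)"
        by (simp add: e H)
      ultimately show ?thesis by blast
    next
      case out
      then have "e = (case (u, x) of (u, x) \<Rightarrow> {Inl u, Inr (u, x)})" by (simp add: e)
      then show ?thesis using out by blast
    next
      \<comment> \<open>The outward and the inward arc of a link give the same unordered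
        pair.\<close>
      case into
      then have "e = (case (u, x) of (u, x) \<Rightarrow> {Inl u, Inr (u, x)})"
        by (simp add: e insert_commute)
      then show ?thesis using into by blast
    qed
  qed
  show "?A \<union> ?B \<union> ?C \<subseteq> ?L"
  proof (intro Un_least image_subsetI)
    fix e assume "e \<in> edges G"
    then obtain u v where "e = {u, v}" "(u, v) \<in> parcs G" by (auto simp: edges_def)
    then have "Inl ` e = {Inl u, Inl v}" "(Inl u, Inl v) \<in> parcs (corona G H)"
      by (auto simp: corona_def)
    then show "Inl ` e \<in> ?L" unfolding edges_def by blast
  next
    fix ue assume "ue \<in> pverts G \<times> edges H"
    then obtain u x y where "ue = (u, {x, y})" "u \<in> pverts G" "(x, y) \<in> parcs H"
      by (auto simp: edges_def)
    then have "(case ue of (u, e) \<Rightarrow> (\<lambda>x. Inr (u, x)) ` e) = {Inr (u, x), Inr (u, y)}"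
        "(Inr (u, x), Inr (u, y)) \<in> parcs (corona G H)"
      by (auto simp: corona_def)
    then show "(case ue of (u, e) \<Rightarrow> (\<lambda>x. Inr (u, x)) ` e) \<in> ?L"
      unfolding edges_def by blast
  next
    fix ux assume "ux \<in> pverts G \<times> pverts H"
    then obtain u x where "ux = (u, x)" "(Inl u, Inr (u, x)) \<in> parcs (corona G H)"
      by (auto simp: corona_def)
    then show "(case ux of (u, x) \<Rightarrow> {Inl u, Inr (u, x)}) \<in> ?L"
      unfolding edges_def by blast
  qed
qed

text \<open>The three families of edges have both ends \<open>Inl\<close>, both \<open>Inr\<close>,
  or one of each, so they are disjoint, and each is parametrised injectively.\<close>

lemma sum_edges_corona:
  fixes w :: "('a + 'a \<times> 'b) set \<Rightarrow> 'c::comm_monoid_add"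
  assumes G: "simple_graph G" and H: "simple_graph H"
  shows "sum w (edges (corona G H)) =
      (\<Sum>e\<in>edges G. w (Inl ` e))
      + (\<Sum>u\<in>pverts G. (\<Sum>e\<in>edges H. w ((\<lambda>x. Inr (u, x)) ` e))
                       + (\<Sum>x\<in>pverts H. w {Inl u, Inr (u, x)}))"
proof -
  let ?fB = "\<lambda>(u, e). (\<lambda>x. Inr (u, x) :: 'a + 'a \<times> 'b) ` e"
  let ?fC = "\<lambda>(u, x). {Inl u, Inr (u, x) :: 'a + 'a \<times> 'b}"
  let ?A = "(`) Inl ` edges G :: ('a + 'a \<times> 'b) set set"
  let ?B = "?fB ` (pverts G \<times> edges H)"
  let ?C = "?fC ` (pverts G \<times> pverts H)"
  note fin = finite_simple_graph[OF G] finite_simple_graph[OF H]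
  have injA: "inj_on ((`) Inl :: 'a set \<Rightarrow> ('a + 'a \<times> 'b) set) (edges G)"
    by (auto simp: inj_on_def inj_image_eq_iff)
  \<comment> \<open>Nonemptiness lets \<open>the_elem\<close> recover u from an edge in the copy at
    u, as its only first component.\<close>
  have "e \<noteq> {}" if "e \<in> edges H" for e
    using that by (auto simp: edges_def)
  then have injB: "inj_on ?fB (pverts G \<times> edges H)"
    by (intro inj_on_inverseI[where g = "\<lambda>S. (the_elem (fst ` projr ` S), snd ` projr ` S)"])
       (auto simp: image_image image_constant_conv)
  have injC: "inj_on ?fC (pverts G \<times> pverts H)"
    by (auto simp: inj_on_def doubleton_eq_iff)
  have disj: "?A \<inter> ?B = {}" "(?A \<union> ?B) \<inter> ?C = {}"
    by (auto simp: edges_def doubleton_eq_iff)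
  have "sum w (edges (corona G H)) = sum w ?A + sum w ?B + sum w ?C"
    unfolding edges_corona using fin disj by (simp add: sum.union_disjoint)
  also have "\<dots> = (\<Sum>e\<in>edges G. w (Inl ` e))
      + (\<Sum>(u, e)\<in>pverts G \<times> edges H. w ((\<lambda>x. Inr (u, x)) ` e))
      + (\<Sum>(u, x)\<in>pverts G \<times> pverts H. w {Inl u, Inr (u, x)})"
    unfolding sum.reindex[OF injA] sum.reindex[OF injB] sum.reindex[OF injC]
    by (simp add: case_prod_unfold comp_def)
  finally show ?thesis
    by (simp add: sum.cartesian_product sum.distrib add.assoc)
qed

text \<open>\<open>connected\<close> refers to the symmetric closure; the arcs are symmetric
  already, so plain reachability is the same relation.\<close>

lemma connected_graph_iff:
  assumes "simple_graph G"
  shows "connected_graph G \<longleftrightarrow> (\<forall>u\<in>pverts G. \<forall>v\<in>pverts G. u \<rightarrow>\<^sup>*\<^bsub>with_proj G\<^esub> v)"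
proof -
  interpret pair_graph G using assms by (simp add: simple_graph_def)
  have "symmetric (with_proj G)" by (rule pair_sym_arcs)
  then show ?thesis
    using assms by (simp add: connected_def strongly_connected_def reachable_mk_symmetric_eq simple_graph_def)
qed

text \<open>Every vertex is a root or adjacent to one, and a walk of \<open>G\<close> joins any two
  roots.\<close>

lemma connected_graph_corona:
  assumes G: "simple_graph G" and H: "simple_graph H" and conn: "connected_graph G"
  shows "connected_graph (corona G H)"
proof -
  interpret G: pair_graph G using G by (simp add: simple_graph_def)
  note C_simple = simple_graph_corona[OF G H]
  interpret C: pair_graph "corona G H" using C_simple by (simp add: simple_graph_def)
  have lift: "Inl u \<rightarrow>\<^sup>*\<^bsub>with_proj (corona G H)\<^esub> Inl v" if "u \<rightarrow>\<^sup>*\<^bsub>with_proj G\<^esub> v" for u v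
    using that
  proof (induction rule: G.reachable_induct)
    case base
    then show ?case by (intro C.reachable_refl) (auto simp: corona_def)
  next
    case (step x y)
    then have "(Inl x, Inl y) \<in> parcs (corona G H)"
      by (auto simp: corona_def)
    then show ?case using step.IH C.reachable_adj_trans by simp
  qed
  have root: "\<exists>u\<in>pverts G. s \<rightarrow>\<^sup>*\<^bsub>with_proj (corona G H)\<^esub> Inl u
      \<and> Inl u \<rightarrow>\<^sup>*\<^bsub>with_proj (corona G H)\<^esub> s" if "s \<in> pverts (corona G H)" for s
  proof -
    from that consider u where "s = Inl u" "u \<in> pverts G"
      | u x where "s = Inr (u, x)" "u \<in> pverts G" "x \<in> pverts H"
      by (auto simp: corona_def)
    then show ?thesis
    proof cases
      case 1
      then show ?thesis using that by (intro bexI[of _ u]) auto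
    next
      case 2
      then have "(s, Inl u) \<in> parcs (corona G H)" "(Inl u, s) \<in> parcs (corona G H)"
        by (auto simp: corona_def)
      then show ?thesis using 2 by (intro bexI[of _ u]) auto
    qed
  qed
  show ?thesis
    unfolding connected_graph_iff[OF C_simple]
  proof (intro ballI)
    fix s t assume "s \<in> pverts (corona G H)" "t \<in> pverts (corona G H)"
    then obtain u v where "u \<in> pverts G" "v \<in> pverts G"
      "s \<rightarrow>\<^sup>*\<^bsub>with_proj (corona G H)\<^esub> Inl u" "Inl v \<rightarrow>\<^sup>*\<^bsub>with_proj (corona G H)\<^esub> t"
      using root by meson
    moreover from this have "Inl u \<rightarrow>\<^sup>*\<^bsub>with_proj (corona G H)\<^esub> Inl v"
      using conn lift by (simp add: connected_graph_iff[OF G])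
    ultimately show "s \<rightarrow>\<^sup>*\<^bsub>with_proj (corona G H)\<^esub> t"
      using C.reachable_trans by blast
  qed
qed

section \<open>The labeling\<close>

text \<open>Symbols 0 and -1 both give label 0, so the case split and the halving collapse to one
  test.\<close>

lemma FLC_edge_label_eq:
  "FLC_edge_label a b p f e = (if Legendre (\<Sum>w\<in>e. fibseq a b (f w)) (int p) = 1 then 1 else 0)"
  by (auto simp: FLC_edge_label_def Let_def Legendre_def)

text \<open>Label 1 has sign 1 and label 0 has sign -1, so cordiality becomes a bound on one signed
  sum over the edges.\<close>

lemma edge_count_diff:
  assumes "finite (edges \<Gamma>)"
  shows "int (edge_count a b p \<Gamma> f 1) - int (edge_count a b p \<Gamma> f 0)
      = (\<Sum>e\<in>edges \<Gamma>. qr_sign p (\<Sum>w\<in>e. fibseq a b (f w)))"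
proof -
  let ?l = "FLC_edge_label a b p f"
  have count: "int (edge_count a b p \<Gamma> f i) = (\<Sum>e\<in>edges \<Gamma>. if ?l e = i then 1 else 0)" for i
    using assms by (auto simp: edge_count_def sum.If_cases Int_def)
  have "qr_sign p (\<Sum>w\<in>e. fibseq a b (f w))
      = (if ?l e = 1 then 1 else 0) - (if ?l e = 0 then 1 else 0)" for e
    by (simp add: qr_sign_def FLC_edge_label_eq)
  then show ?thesis
    by (simp add: count sum_subtractf)
qed

text \<open>Labels are written as quotient times t plus remainder. With \<open>g\<close> onto
  1..t-1, \<open>g u\<close> is the nonzero remainder of the copy at u, and \<open>g u - 1\<close>
  is the quotient of the root u, whose remainder is 0.\<close>

fun corona_label :: "nat \<Rightarrow> ('a \<Rightarrow> nat) \<Rightarrow> ('b \<Rightarrow> nat) \<Rightarrow> 'a + 'a \<times> 'b \<Rightarrow> nat" where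
  "corona_label t g h (Inl u) = (g u - 1) * t"
| "corona_label t g h (Inr (u, x)) = h x * t + g u"

text \<open>Remainder 0 marks a root, found from its quotient; a nonzero remainder names the copy
  and the quotient the vertex in it. Injectivity and a count then give surjectivity.\<close>

lemma bij_betw_corona_label:
  assumes g: "bij_betw g (pverts G) {1..<t}" and h: "bij_betw h (pverts H) {0..<t - 1}"
  shows "bij_betw (corona_label t g h) (pverts (corona G H)) {0..<graph_order (corona G H)}"
proof -
  let ?f = "corona_label t g h"
  let ?V = "pverts (corona G H)"
  have g_range: "1 \<le> g u" "g u < t" if "u \<in> pverts G" for u
    using bij_betwE[OF g] that by auto
  have h_range: "h x < t - 1" if "x \<in> pverts H" for x
    using bij_betwE[OF h] that by auto
  have fin: "finite (pverts G)" "finite (pverts H)"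
    using bij_betw_finite[OF g] bij_betw_finite[OF h] by auto
  have V: "?V = Sum_Type.Plus (pverts G) (pverts G \<times> pverts H)"
    by (auto simp: corona_def Plus_def)
  have card_V: "card ?V = (t - 1) * t"
    using fin bij_betw_same_card[OF g] bij_betw_same_card[OF h]
    by (cases t) (simp_all add: V card_Plus card_cartesian_product)
  have mod_f: "?f (Inl u) mod t = 0" "?f (Inr (u, x)) mod t = g u" if "u \<in> pverts G" for u x
    using g_range[OF that] by auto
  have div_f: "?f (Inl u) div t = g u - 1" "?f (Inr (u, x)) div t = h x" if "u \<in> pverts G" for u x
    using g_range[OF that] by auto
  have inj: "inj_on ?f ?V"
  proof (rule inj_onI)
    fix s s' assume s: "s \<in> ?V" "s' \<in> ?V" and eq: "?f s = ?f s'"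
    have eq': "?f s mod t = ?f s' mod t" "?f s div t = ?f s' div t"
      by (simp_all only: eq)
    from s consider
      (GG) u v where "s = Inl u" "s' = Inl v" "u \<in> pverts G" "v \<in> pverts G"
    | (GH) u v y where "s = Inl u" "s' = Inr (v, y)" "u \<in> pverts G" "v \<in> pverts G"
    | (HG) u v x where "s = Inr (u, x)" "s' = Inl v" "u \<in> pverts G" "v \<in> pverts G"
    | (HH) u v x y where "s = Inr (u, x)" "s' = Inr (v, y)" "u \<in> pverts G" "v \<in> pverts G"
        "x \<in> pverts H" "y \<in> pverts H"
      unfolding V by (elim PlusE) auto
    then show "s = s'"
    proof cases
      case GG
      then have "g u = g v"
        using eq'(2) div_f(1) g_range(1)[of u] g_range(1)[of v] by (simp del: corona_label.simps)
      then show ?thesis using GG bij_betw_imp_inj_on[OF g] by (auto dest: inj_onD)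
    next
      case GH
      then show ?thesis
        using eq'(1) mod_f g_range(1)[of v] by (simp del: corona_label.simps)
    next
      case HG
      then show ?thesis
        using eq'(1) mod_f g_range(1)[of u] by (simp del: corona_label.simps)
    next
      case HH
      then have "g u = g v" "h x = h y"
        using eq' mod_f(2) div_f(2) by (simp_all del: corona_label.simps)
      then show ?thesis
        using HH bij_betw_imp_inj_on[OF g] bij_betw_imp_inj_on[OF h] by (auto dest: inj_onD)
    qed
  qed
  \<comment> \<open>Both \<open>g u - 1\<close> and \<open>h x\<close> are at most t - 2.\<close>
  have "?f s < (t - 1) * t" if "s \<in> ?V" for s
  proof -
    have "?f s div t < t - 1 \<and> t > 0"
      using that unfolding V
      by (elim PlusE) (use g_range h_range div_f in \<open>fastforce simp del: corona_label.simps\<close>)+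
    then show ?thesis
      using div_less_iff_less_mult by blast
  qed
  then have "?f ` ?V \<subseteq> {0..<(t - 1) * t}"
    by auto
  then have "?f ` ?V = {0..<(t - 1) * t}"
    by (rule card_subset_eq[OF finite_atLeastLessThan]) (simp add: card_image[OF inj] card_V)
  then show ?thesis
    using inj by (simp add: bij_betw_def graph_order_def card_V)
qed

theorem theorem3p7:
  fixes b k \<epsilon> :: int
    and p m :: nat
    and G :: "'a pair_pre_digraph"
    and H :: "'b pair_pre_digraph"
  assumes "b \<noteq> 0"
    and "k \<ge> -1"
    and "k \<in> pisano_set 0 b"
    and "PL_prime k 0 b p"
    and "simple_graph H"
    and "int (graph_order H) = int (pisano_period p 0 b) - 1"
    and "graph_size H = m"
    and "simple_graph G"
    and "connected_graph G"
    and "int (graph_order G) = int (pisano_period p 0 b) - 1"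
    and "\<epsilon> \<in> {-1, 0, 1}"
    and "int (graph_size G) = (k + 1) * (int m + int (pisano_period p 0 b) - 1) + \<epsilon>"
    and "[int p = 1] (mod 8) \<or> [int p = -1] (mod 8) \<or> m = 0"
  shows "FLC_graph 0 b p (corona G H)"
proof -
  let ?t = "pisano_period p 0 b"
  let ?F = "fibseq 0 b"
  let ?q = "qr_sign p"
  note fin = finite_simple_graph[OF \<open>simple_graph G\<close>] finite_simple_graph[OF \<open>simple_graph H\<close>]
  have "prime p"
    using \<open>PL_prime k 0 b p\<close> by (simp add: PL_prime_def)
  then have "p > 0" by (rule prime_gt_0_nat)
  have "?t > 0" by (rule fibseq_pisano_period(1)[OF \<open>p > 0\<close>])
  have card: "card (pverts G) = ?t - 1" "card (pverts H) = ?t - 1"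
    using assms(6,10) by (simp_all add: graph_order_def)
  obtain g where g: "bij_betw g (pverts G) {1..<?t}"
    using finite_same_card_bij[OF fin(1), of "{1..<?t}"] card by auto
  obtain h where h: "bij_betw h (pverts H) {0..<?t - 1}"
    using finite_same_card_bij[OF fin(3), of "{0..<?t - 1}"] card by auto
  define f where "f = corona_label ?t g h"
  \<comment> \<open>Roots have indices divisible by the period, and the sequence starts with
    0.\<close>
  have F_Inl: "[?F (f (Inl u)) = 0] (mod int p)" for u
    using fibseq_mult_pisano_period[OF \<open>p > 0\<close>, of 0 b "g u - 1" 0] by (simp add: f_def)
  have F_Inr: "[?F (f (Inr (u, x))) = ?F (g u)] (mod int p)" for u x
    using fibseq_mult_pisano_period[OF \<open>p > 0\<close>, of 0 b "h x" "g u"] by (simp add: f_def)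
  define w where "w e = ?q (\<Sum>s\<in>e. ?F (f s))" for e
  have w_G: "w (Inl ` e) = -1" if "e \<in> edges G" for e
  proof -
    have "[(\<Sum>s\<in>Inl ` e. ?F (f s)) = (\<Sum>u\<in>e. 0)] (mod int p)"
      unfolding sum.reindex[OF inj_on_subset[OF inj_Inl subset_UNIV]] comp_def
      by (intro cong_sum F_Inl)
    then show ?thesis
      by (simp add: w_def qr_sign_cong)
  qed
  have w_H: "w ((\<lambda>x. Inr (u, x)) ` e) = ?q (?F (g u))" if e: "e \<in> edges H" for u e
  proof -
    obtain x y where xy: "e = {x, y}" "x \<noteq> y"
      using edges_simple_graph[OF \<open>simple_graph H\<close> e] by metis
    \<comment> \<open>The edge \<open>e\<close> rules out the alternative m = 0, which leaves the
      condition mod 8.\<close>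
    have "m \<noteq> 0"
      using e fin(4) \<open>graph_size H = m\<close> by (auto simp: graph_size_def card_gt_0_iff)
    have "w ((\<lambda>x. Inr (u, x)) ` e) = ?q (?F (f (Inr (u, x))) + ?F (f (Inr (u, y))))"
      using xy by (simp add: w_def)
    also have "\<dots> = ?q (?F (g u) + ?F (g u))"
      by (intro qr_sign_cong cong_add F_Inr)
    also have "\<dots> = ?q (?F (g u))"
      using \<open>prime p\<close> assms(13) \<open>m \<noteq> 0\<close> by (intro qr_sign_double) auto
    finally show ?thesis .
  qed
  have w_link: "w {Inl u, Inr (u, x)} = ?q (?F (g u))" for u x
    using cong_add[OF F_Inl[of u] F_Inr[of u x]] by (simp add: w_def qr_sign_cong)
  \<comment> \<open>No copy has residue 0. Dropping that index removes a sign -1, which turns the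
    sum k into k + 1.\<close>
  have "{..<?t} = insert 0 {1..<?t}"
    using \<open>?t > 0\<close> by auto
  then have "(\<Sum>\<xi>\<in>{1..<?t}. ?q (?F \<xi>)) = k + 1"
    using PL_prime_sum[OF \<open>PL_prime k 0 b p\<close>] by simp
  then have sum_g: "(\<Sum>u\<in>pverts G. ?q (?F (g u))) = k + 1"
    using sum.reindex_bij_betw[OF g, of "\<lambda>\<xi>. ?q (?F \<xi>)"] by simp
  \<comment> \<open>The copy at u contributes m inner edges and t - 1 links, all with the sign of F
    at \<open>g u\<close>.\<close>
  have "sum w (edges (corona G H))
      = - int (graph_size G) + (\<Sum>u\<in>pverts G. (int m + (int ?t - 1)) * ?q (?F (g u)))"
    using \<open>?t > 0\<close> \<open>graph_size H = m\<close>
    by (simp add: sum_edges_corona[OF \<open>simple_graph G\<close> \<open>simple_graph H\<close>] w_G w_H w_link card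
        graph_size_def algebra_simps)
  \<comment> \<open>The copies contribute (k + 1)(m + t - 1), which the size of \<open>G\<close>
    cancels up to \<epsilon>.\<close>
  also have "\<dots> = - \<epsilon>"
    unfolding sum_distrib_left[symmetric] sum_g using assms(12) by (simp add: algebra_simps)
  finally have "\<bar>int (edge_count 0 b p (corona G H) f 0)
      - int (edge_count 0 b p (corona G H) f 1)\<bar> \<le> 1"
    using edge_count_diff[of "corona G H" 0 b p f]
      finite_simple_graph(2)[OF simple_graph_corona[OF \<open>simple_graph G\<close> \<open>simple_graph H\<close>]]
      \<open>\<epsilon> \<in> {-1, 0, 1}\<close>
    by (auto simp: w_def)
  then have "FLC_labeling 0 b p (corona G H) f"
    using bij_betw_corona_label[OF g h] by (simp add: FLC_labeling_def f_def)
  then show ?thesis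
    using simple_graph_corona[OF \<open>simple_graph G\<close> \<open>simple_graph H\<close>]
      connected_graph_corona[OF \<open>simple_graph G\<close> \<open>simple_graph H\<close> \<open>connected_graph G\<close>]
    by (auto simp: FLC_graph_def)
qed

end
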